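(* Let $h:\mathbb{R}^n\to\overline{\mathbb{R}}$ be a proper function and let $\overline{x}\in\arg\min_{\mathbb{R}^n}h$. Assume that $h$ is $(\kappa,\gamma)$-strongly quasar-convex with respect to $\overline{x}$, where $\kappa\in(0,1]$ and $\gamma\ge 0$. Then the following assertions hold: (a) For every $\alpha>0$, the function $g(x):=\alpha h(x)$ is $(\kappa,\alpha\gamma)$-strongly quasar-convex with respect to $\overline{x}$. (b) Define $g(z):=h(\overline{x}+z)$. Then $g$ is $(\kappa,\gamma)$-strongly quasar-convex with respect to $\overline{z}=0\in\arg\min_{\mathbb{R}^n}g$. (c) For every $\theta\in(0,1]$, the function $h$ is $(\theta\kappa,\frac{\gamma}{\theta})$-strongly quasar-convex with respect to $\overline{x}$.
   Context: $\overline{\mathbb{R}}=\mathbb{R}\cup\{+\infty\}$; $\mathrm{dom}(h)=\{x:h(x)<+\infty\}$; $h$ is proper if $\mathrm{dom}(h)\neq\emptyset$; $\|\cdot\|$ is the Euclidean norm. Let $\kappa\in(0,1]$, $\gamma\ge 0$. A proper function $h:\mathbb{R}^n\to\overline{\mathbb{R}}$ with convex domain and $\arg\min_{\mathbb{R}^n}h\neq\emptyset$ is called $(\kappa,\gamma)$-strongly quasar-convex with respect to $\overline{x}\in\arg\min_{\mathbb{R}^n}h$ if for all $x\in\mathrm{dom}(h)$ and all $\lambda\in[0,1]$, $$h(\lambda\overline{x}+(1-\lambda)x)\le\kappa\lambda h(\overline{x})+(1-\kappa\lambda)h(x)-\lambda\left(1-\frac{\lambda}{2-\kappa}\right)\frac{\kappa\gamma}{2}\|x-\overline{x}\|^2.$$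 *)

theory Defs
  imports "HOL-Analysis.Analysis"
begin

definition eff_dom :: "('a \<Rightarrow> ereal) \<Rightarrow> 'a set" where
  "eff_dom h = {x. h x < \<infinity>}"

(* Functions into R \<union> {+\<infinity>} are ereal-valued functions that never take the value -\<infinity>;
   this requirement on the codomain is made part of properness. *)
definition proper_fun :: "('a \<Rightarrow> ereal) \<Rightarrow> bool" where
  "proper_fun h \<longleftrightarrow> (\<forall>x. h x \<noteq> -\<infinity>) \<and> eff_dom h \<noteq> {}"

definition argmin_set :: "('a \<Rightarrow> ereal) \<Rightarrow> 'a set" where
  "argmin_set h = {x. is_arg_min h (\<lambda>_. True) x}"

(* In the inequality both h xbar and h x are finite (xbar minimises a proper function and
   x lies in the effective domain), so the ereal arithmetic on the right is real arithmetic. *)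
definition strongly_quasar_convex ::
  "real \<Rightarrow> real \<Rightarrow> ('a::real_normed_vector \<Rightarrow> ereal) \<Rightarrow> 'a \<Rightarrow> bool" where
  "strongly_quasar_convex \<kappa> \<gamma> h xbar \<longleftrightarrow>
     0 < \<kappa> \<and> \<kappa> \<le> 1 \<and> 0 \<le> \<gamma> \<and>
     proper_fun h \<and> convex (eff_dom h) \<and> xbar \<in> argmin_set h \<and>
     (\<forall>x\<in>eff_dom h. \<forall>t\<in>{0..1}.
        h (t *\<^sub>R xbar + (1 - t) *\<^sub>R x)
          \<le> ereal (\<kappa> * t) * h xbar + ereal (1 - \<kappa> * t) * h x
             - ereal (t * (1 - t / (2 - \<kappa>)) * (\<kappa> * \<gamma> / 2) * (norm (x - xbar))\<^sup>2))"

end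

theory Submission
  imports Defs
begin

text \<open>
  Positive scaling multiplies every term of the defining inequality by \<open>\<alpha>\<close>, and a translation
  carries convex combinations to convex combinations; neither changes the minimisers except for
  the obvious shift. The third assertion is the one with content. Passing from \<open>(\<kappa>, \<gamma>)\<close> to
  \<open>(\<theta> * \<kappa>, \<gamma> / \<theta>)\<close> leaves the product \<open>\<kappa> * \<gamma>\<close> unchanged; the upper bound gains
  \<open>\<kappa> * t * (1 - \<theta>) * (h x - h xbar)\<close> and loses a term of order \<open>t\<^sup>2\<close>, because \<open>2 - \<theta> * \<kappa>\<close>
  replaces \<open>2 - \<kappa>\<close> in a denominator. Since
  \<open>1 / (2 - \<kappa>) - 1 / (2 - \<theta> * \<kappa>) = \<kappa> * (1 - \<theta>) / ((2 - \<kappa>) * (2 - \<theta> * \<kappa>))\<close>, the loss is covered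
  by the quadratic growth \<open>h x - h xbar \<ge> \<kappa> * \<gamma> / (2 * (2 - \<kappa>)) * (norm (x - xbar))\<^sup>2\<close>
  (lemma \<open>quasar_quadratic_growth\<close>). Growth in turn follows by bounding the left-hand side of
  the defining inequality below by the minimum \<open>h xbar\<close>: take \<open>t = 1\<close> when \<open>\<kappa> < 1\<close>, and let \<open>t\<close>
  tend to \<open>1\<close> when \<open>\<kappa> = 1\<close>.
\<close>

lemma argmin_set_iff: "x \<in> argmin_set h \<longleftrightarrow> (\<forall>y. h x \<le> h y)"
  by (auto simp: argmin_set_def is_arg_min_linorder)

lemma proper_fun_finite:
  assumes "proper_fun h" "x \<in> eff_dom h"
  obtains r where "h x = ereal r"
  using assms by (cases "h x") (auto simp: proper_fun_def eff_dom_def)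

lemma argmin_set_subset_eff_dom:
  assumes "proper_fun h"
  shows "argmin_set h \<subseteq> eff_dom h"
  using assms by (fastforce simp: proper_fun_def eff_dom_def argmin_set_iff intro: le_less_trans)

text \<open>
  Once the two values on the right-hand side are known to be real, the extended-real inequality
  is an inequality against a real upper bound.
\<close>

lemma strongly_quasar_convexD:
  assumes "strongly_quasar_convex \<kappa> \<gamma> h xbar" "h xbar = ereal m" "h x = ereal a" "0 \<le> t" "t \<le> 1"
  shows "h (t *\<^sub>R xbar + (1 - t) *\<^sub>R x)
    \<le> ereal (\<kappa> * t * m + (1 - \<kappa> * t) * a
             - t * (1 - t / (2 - \<kappa>)) * (\<kappa> * \<gamma> / 2) * (norm (x - xbar))\<^sup>2)"
proof -
  have "x \<in> eff_dom h" using assms(3) by (simp add: eff_dom_def)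
  moreover have "t \<in> {0..1}" using assms(4,5) by simp
  ultimately have "h (t *\<^sub>R xbar + (1 - t) *\<^sub>R x)
    \<le> ereal (\<kappa> * t) * h xbar + ereal (1 - \<kappa> * t) * h x
       - ereal (t * (1 - t / (2 - \<kappa>)) * (\<kappa> * \<gamma> / 2) * (norm (x - xbar))\<^sup>2)"
    using assms(1) unfolding strongly_quasar_convex_def by blast
  then show ?thesis by (simp add: assms(2,3))
qed

lemma strongly_quasar_convexI:
  assumes "0 < \<kappa>" "\<kappa> \<le> 1" "0 \<le> \<gamma>" "proper_fun h" "convex (eff_dom h)" "xbar \<in> argmin_set h"
    and "\<And>x m a t. h xbar = ereal m \<Longrightarrow> h x = ereal a \<Longrightarrow> 0 \<le> t \<Longrightarrow> t \<le> 1 \<Longrightarrow>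
      h (t *\<^sub>R xbar + (1 - t) *\<^sub>R x)
        \<le> ereal (\<kappa> * t * m + (1 - \<kappa> * t) * a
             - t * (1 - t / (2 - \<kappa>)) * (\<kappa> * \<gamma> / 2) * (norm (x - xbar))\<^sup>2)"
  shows "strongly_quasar_convex \<kappa> \<gamma> h xbar"
proof -
  have "h (t *\<^sub>R xbar + (1 - t) *\<^sub>R x)
      \<le> ereal (\<kappa> * t) * h xbar + ereal (1 - \<kappa> * t) * h x
         - ereal (t * (1 - t / (2 - \<kappa>)) * (\<kappa> * \<gamma> / 2) * (norm (x - xbar))\<^sup>2)"
    if x: "x \<in> eff_dom h" and t: "t \<in> {0..1}" for x t
  proof -
    obtain a where a: "h x = ereal a"
      by (rule proper_fun_finite[OF assms(4) x])
    obtain m where m: "h xbar = ereal m"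
      using proper_fun_finite[OF assms(4)] argmin_set_subset_eff_dom[OF assms(4)] assms(6) by blast
    show ?thesis using assms(7)[OF m a, of t] t by (simp add: m a)
  qed
  then show ?thesis using assms(1-6) unfolding strongly_quasar_convex_def by blast
qed

lemma quasar_quadratic_growth:
  assumes sqc: "strongly_quasar_convex \<kappa> \<gamma> h xbar" and m: "h xbar = ereal m" and a: "h x = ereal a"
  shows "\<kappa> * \<gamma> / (2 * (2 - \<kappa>)) * (norm (x - xbar))\<^sup>2 \<le> a - m"
proof -
  define D where "D = \<kappa> * \<gamma> / 2 * (norm (x - xbar))\<^sup>2"
  have \<kappa>: "0 < \<kappa>" "\<kappa> \<le> 1" and min: "\<And>y. h xbar \<le> h y"
    using sqc by (auto simp: strongly_quasar_convex_def argmin_set_iff)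
  have key: "t * (1 - t / (2 - \<kappa>)) * D \<le> (1 - \<kappa> * t) * (a - m)" if "0 \<le> t" "t \<le> 1" for t
  proof -
    have "ereal m \<le> ereal (\<kappa> * t * m + (1 - \<kappa> * t) * a
             - t * (1 - t / (2 - \<kappa>)) * (\<kappa> * \<gamma> / 2) * (norm (x - xbar))\<^sup>2)"
      using order_trans[OF min strongly_quasar_convexD[OF sqc m a that]] m by simp
    then have "m \<le> \<kappa> * t * m + (1 - \<kappa> * t) * a - t * (1 - t / (2 - \<kappa>)) * D"
      by (simp only: D_def mult.assoc ereal_less_eq(3))
    then show ?thesis by (simp add: algebra_simps)
  qed
  have "D / (2 - \<kappa>) \<le> a - m"
  proof (cases "\<kappa> = 1")
    case True
    \<comment> \<open>At \<open>t = 1\<close> both sides vanish, so a factor \<open>1 - t\<close> is cancelled before taking the limit.\<close>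
    have "t * D \<le> a - m" if "0 < t" "t < 1" for t
    proof -
      have "(1 - t) * (t * D) \<le> (1 - t) * (a - m)"
        using key[of t] that True by (simp add: mult_ac)
      then show ?thesis using that by simp
    qed
    then have "D \<le> a - m"
      by (rule field_le_mult_one_interval)
    then show ?thesis using True by simp
  next
    case False
    have "1 - 1 / (2 - \<kappa>) = (1 - \<kappa>) / (2 - \<kappa>)"
      using \<kappa> by (simp add: field_simps)
    then have "(1 - \<kappa>) * (D / (2 - \<kappa>)) \<le> (1 - \<kappa>) * (a - m)"
      using key[of 1] by simp
    then show ?thesis using False \<kappa> by (simp only: mult_le_cancel_left)
  qed
  then show ?thesis by (simp add: D_def)
qed

lemma strongly_quasar_convex_scale:
  assumes sqc: "strongly_quasar_convex \<kappa> \<gamma> h xbar" and \<alpha>: "0 < \<alpha>"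
  shows "strongly_quasar_convex \<kappa> (\<alpha> * \<gamma>) (\<lambda>x. ereal \<alpha> * h x) xbar"
proof -
  have h: "0 < \<kappa>" "\<kappa> \<le> 1" "0 \<le> \<gamma>" "proper_fun h" "convex (eff_dom h)" "xbar \<in> argmin_set h"
    using sqc by (auto simp: strongly_quasar_convex_def)
  have nminf: "ereal \<alpha> * h x \<noteq> -\<infinity>" for x
    using h(4) \<alpha> by (cases "h x") (auto simp: proper_fun_def)
  have dom: "eff_dom (\<lambda>x. ereal \<alpha> * h x) = eff_dom h"
  proof -
    have "ereal \<alpha> * h x < \<infinity> \<longleftrightarrow> h x < \<infinity>" for x
      using \<alpha> by (cases "h x") auto
    then show ?thesis by (simp add: eff_dom_def)
  qed
  show ?thesis
  proof (rule strongly_quasar_convexI)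
    show "proper_fun (\<lambda>x. ereal \<alpha> * h x)"
      using h(4) nminf by (simp add: proper_fun_def dom)
    show "convex (eff_dom (\<lambda>x. ereal \<alpha> * h x))" using h(5) by (simp add: dom)
    show "xbar \<in> argmin_set (\<lambda>x. ereal \<alpha> * h x)"
      using h(6) \<alpha> by (auto simp: argmin_set_iff intro: ereal_mult_left_mono)
    fix x m a and t :: real
    assume m: "ereal \<alpha> * h xbar = ereal m" and a: "ereal \<alpha> * h x = ereal a" and t: "0 \<le> t" "t \<le> 1"
    obtain m' where m': "h xbar = ereal m'" "m = \<alpha> * m'"
      using m \<alpha> by (cases "h xbar") auto
    obtain a' where a': "h x = ereal a'" "a = \<alpha> * a'"
      using a \<alpha> by (cases "h x") auto
    have "ereal \<alpha> * h (t *\<^sub>R xbar + (1 - t) *\<^sub>R x)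
      \<le> ereal \<alpha> * ereal (\<kappa> * t * m' + (1 - \<kappa> * t) * a'
             - t * (1 - t / (2 - \<kappa>)) * (\<kappa> * \<gamma> / 2) * (norm (x - xbar))\<^sup>2)"
      using strongly_quasar_convexD[OF sqc m'(1) a'(1) t] \<alpha> by (intro ereal_mult_left_mono) auto
    also have "\<dots> = ereal (\<kappa> * t * m + (1 - \<kappa> * t) * a
             - t * (1 - t / (2 - \<kappa>)) * (\<kappa> * (\<alpha> * \<gamma>) / 2) * (norm (x - xbar))\<^sup>2)"
      by (simp add: m' a' algebra_simps)
    finally show "ereal \<alpha> * h (t *\<^sub>R xbar + (1 - t) *\<^sub>R x)
      \<le> ereal (\<kappa> * t * m + (1 - \<kappa> * t) * a
             - t * (1 - t / (2 - \<kappa>)) * (\<kappa> * (\<alpha> * \<gamma>) / 2) * (norm (x - xbar))\<^sup>2)" .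
  qed (use h \<alpha> in auto)
qed

lemma strongly_quasar_convex_translate:
  assumes sqc: "strongly_quasar_convex \<kappa> \<gamma> h xbar"
  shows "strongly_quasar_convex \<kappa> \<gamma> (\<lambda>z. h (xbar + z)) 0"
proof -
  have h: "0 < \<kappa>" "\<kappa> \<le> 1" "0 \<le> \<gamma>" "proper_fun h" "convex (eff_dom h)" "xbar \<in> argmin_set h"
    using sqc by (auto simp: strongly_quasar_convex_def)
  have dom: "eff_dom (\<lambda>z. h (xbar + z)) = (\<lambda>x. x - xbar) ` eff_dom h"
  proof -
    have "z \<in> (\<lambda>x. x - xbar) ` eff_dom h" if "h (xbar + z) < \<infinity>" for z
      using that by (intro image_eqI[of _ _ "xbar + z"]) (simp_all add: eff_dom_def)
    then show ?thesis by (auto simp: eff_dom_def)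
  qed
  show ?thesis
  proof (rule strongly_quasar_convexI)
    show "proper_fun (\<lambda>z. h (xbar + z))"
      using h(4) by (simp add: proper_fun_def dom)
    show "convex (eff_dom (\<lambda>z. h (xbar + z)))"
      unfolding dom using h(5) by (simp add: convex_translation_subtract_eq)
    show "0 \<in> argmin_set (\<lambda>z. h (xbar + z))"
      using h(6) by (simp add: argmin_set_iff)
    fix z m a and t :: real
    assume m: "h (xbar + 0) = ereal m" and a: "h (xbar + z) = ereal a" and t: "0 \<le> t" "t \<le> 1"
    have "xbar + (t *\<^sub>R 0 + (1 - t) *\<^sub>R z) = t *\<^sub>R xbar + (1 - t) *\<^sub>R (xbar + z)"
      by (simp add: algebra_simps)
    then show "h (xbar + (t *\<^sub>R 0 + (1 - t) *\<^sub>R z))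
      \<le> ereal (\<kappa> * t * m + (1 - \<kappa> * t) * a
             - t * (1 - t / (2 - \<kappa>)) * (\<kappa> * \<gamma> / 2) * (norm (z - 0))\<^sup>2)"
      using strongly_quasar_convexD[OF sqc _ a t] m by simp
  qed (use h in auto)
qed

lemma strongly_quasar_convex_rescale_parameters:
  assumes sqc: "strongly_quasar_convex \<kappa> \<gamma> h xbar" and \<theta>: "0 < \<theta>" "\<theta> \<le> 1"
  shows "strongly_quasar_convex (\<theta> * \<kappa>) (\<gamma> / \<theta>) h xbar"
proof -
  have h: "0 < \<kappa>" "\<kappa> \<le> 1" "0 \<le> \<gamma>" "proper_fun h" "convex (eff_dom h)" "xbar \<in> argmin_set h"
    using sqc by (auto simp: strongly_quasar_convex_def)
  have \<theta>\<kappa>: "\<theta> * \<kappa> \<le> 1" using \<theta> h by (simp add: mult_le_one)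
  show ?thesis
  proof (rule strongly_quasar_convexI)
    fix x m a and t :: real
    assume m: "h xbar = ereal m" and a: "h x = ereal a" and t: "0 \<le> t" "t \<le> 1"
    define D where "D = \<kappa> * \<gamma> / 2 * (norm (x - xbar))\<^sup>2"
    have D0: "0 \<le> D" using h by (simp add: D_def)
    have growth: "D / (2 - \<kappa>) \<le> a - m"
      using quasar_quadratic_growth[OF sqc m a] by (simp add: D_def)
    have "t / (2 - \<theta> * \<kappa>) * (D / (2 - \<kappa>)) \<le> 1 * (D / (2 - \<kappa>))"
      using t \<theta>\<kappa> D0 h by (intro mult_right_mono) auto
    then have "t / (2 - \<theta> * \<kappa>) * (D / (2 - \<kappa>)) \<le> a - m"
      using growth by simp
    then have "(\<kappa> * t * (1 - \<theta>)) * (t / (2 - \<theta> * \<kappa>) * (D / (2 - \<kappa>))) \<le> (\<kappa> * t * (1 - \<theta>)) * (a - m)"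
      using h t \<theta> by (intro mult_left_mono) auto
    moreover have "t * (1 - t / (2 - \<theta> * \<kappa>)) * D - t * (1 - t / (2 - \<kappa>)) * D
        = (\<kappa> * t * (1 - \<theta>)) * (t / (2 - \<theta> * \<kappa>) * (D / (2 - \<kappa>)))"
    proof -
      have "1 / (2 - \<kappa>) - 1 / (2 - \<theta> * \<kappa>) = \<kappa> * (1 - \<theta>) / ((2 - \<theta> * \<kappa>) * (2 - \<kappa>))"
        using \<theta>\<kappa> h by (simp add: field_simps)
      moreover have "t * (1 - t / (2 - \<theta> * \<kappa>)) * D - t * (1 - t / (2 - \<kappa>)) * D
          = t * t * D * (1 / (2 - \<kappa>) - 1 / (2 - \<theta> * \<kappa>))"
        by (simp add: algebra_simps)
      ultimately show ?thesis by simp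
    qed
    ultimately have "\<kappa> * t * m + (1 - \<kappa> * t) * a - t * (1 - t / (2 - \<kappa>)) * D
        \<le> \<theta> * \<kappa> * t * m + (1 - \<theta> * \<kappa> * t) * a - t * (1 - t / (2 - \<theta> * \<kappa>)) * D"
      by (simp add: algebra_simps)
    moreover have "\<theta> * \<kappa> * (\<gamma> / \<theta>) / 2 * (norm (x - xbar))\<^sup>2 = D"
      using \<theta> by (simp add: D_def)
    ultimately have "\<kappa> * t * m + (1 - \<kappa> * t) * a
          - t * (1 - t / (2 - \<kappa>)) * (\<kappa> * \<gamma> / 2) * (norm (x - xbar))\<^sup>2
        \<le> \<theta> * \<kappa> * t * m + (1 - \<theta> * \<kappa> * t) * a
          - t * (1 - t / (2 - \<theta> * \<kappa>)) * (\<theta> * \<kappa> * (\<gamma> / \<theta>) / 2) * (norm (x - xbar))\<^sup>2"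
      by (simp only: D_def mult.assoc)
    then show "h (t *\<^sub>R xbar + (1 - t) *\<^sub>R x)
      \<le> ereal (\<theta> * \<kappa> * t * m + (1 - \<theta> * \<kappa> * t) * a
           - t * (1 - t / (2 - \<theta> * \<kappa>)) * (\<theta> * \<kappa> * (\<gamma> / \<theta>) / 2) * (norm (x - xbar))\<^sup>2)"
      by (intro order_trans[OF strongly_quasar_convexD[OF sqc m a t]]) (simp only: ereal_less_eq(3))
  qed (use h \<theta> \<theta>\<kappa> in auto)
qed

theorem proposition18:
  fixes h :: "real ^ 'n \<Rightarrow> ereal" and xbar :: "real ^ 'n" and \<kappa> \<gamma> :: real
  assumes "proper_fun h"
    and "xbar \<in> argmin_set h"
    and "0 < \<kappa>" and "\<kappa> \<le> 1" and "0 \<le> \<gamma>"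
    and "strongly_quasar_convex \<kappa> \<gamma> h xbar"
  shows "(\<forall>\<alpha>>0. strongly_quasar_convex \<kappa> (\<alpha> * \<gamma>) (\<lambda>x. ereal \<alpha> * h x) xbar) \<and>
         (0 \<in> argmin_set (\<lambda>z. h (xbar + z)) \<and>
          strongly_quasar_convex \<kappa> \<gamma> (\<lambda>z. h (xbar + z)) 0) \<and>
         (\<forall>\<theta>. 0 < \<theta> \<and> \<theta> \<le> 1 \<longrightarrow> strongly_quasar_convex (\<theta> * \<kappa>) (\<gamma> / \<theta>) h xbar)"
proof (intro conjI allI impI)
  show shifted: "strongly_quasar_convex \<kappa> \<gamma> (\<lambda>z. h (xbar + z)) 0"
    using assms(6) by (rule strongly_quasar_convex_translate)
  then show "0 \<in> argmin_set (\<lambda>z. h (xbar + z))"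
    by (simp add: strongly_quasar_convex_def)
  show "strongly_quasar_convex \<kappa> (\<alpha> * \<gamma>) (\<lambda>x. ereal \<alpha> * h x) xbar" if "0 < \<alpha>" for \<alpha>
    using assms(6) that by (rule strongly_quasar_convex_scale)
  show "strongly_quasar_convex (\<theta> * \<kappa>) (\<gamma> / \<theta>) h xbar" if "0 < \<theta> \<and> \<theta> \<le> 1" for \<theta>
    using assms(6) that by (blast intro: strongly_quasar_convex_rescale_parameters)
qed

end
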